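(* For every integer $n\geq 3$, \[ S_{\triangle}(n)\leq\left\lfloor \frac{2}{3}(n-1)^{2}-\frac{5}{3}\right\rfloor . \]
   Context: For a finite set $P$ of points in the Euclidean plane, $S_{\triangle}(P)$ denotes the number of (unordered) triplets of points of $P$ that are the vertices of an isosceles right triangle (nondegenerate, of any size and orientation). For a positive integer $n$, $S_{\triangle}(n)=\max_{|P|=n}S_{\triangle}(P)$, the maximum being over all sets $P$ of $n$ points in the plane. *)

theory Defs
  imports "HOL-Analysis.Analysis"
begin

(* The apex a carries the right angle. *)
definition isosceles_right_triangle :: "real ^ 2 \<Rightarrow> real ^ 2 \<Rightarrow> real ^ 2 \<Rightarrow> bool" where
  "isosceles_right_triangle a b c \<longleftrightarrow>
     \<not> collinear {a, b, c} \<and> dist a b = dist a c \<and> orthogonal (b - a) (c - a)"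

definition S_triangle :: "(real ^ 2) set \<Rightarrow> nat" where
  "S_triangle P =
     card {T. T \<subseteq> P \<and> card T = 3 \<and> (\<exists>a b c. T = {a, b, c} \<and> isosceles_right_triangle a b c)}"

(* Max is only meaningful on finite nonempty sets; the two lemmas below show that it is
   applied to such a set for every n. *)
definition S_triangle_max :: "nat \<Rightarrow> nat" where
  "S_triangle_max n = Max {S_triangle P | P. finite P \<and> card P = n}"

lemma S_triangle_le_choose:
  assumes "finite P"
  shows "S_triangle P \<le> card P choose 3"
proof -
  have "S_triangle P \<le> card {T. T \<subseteq> P \<and> card T = 3}"
    unfolding S_triangle_def using assms by (intro card_mono) auto
  also have "\<dots> = card P choose 3"
    using assms by (rule n_subsets)
  finally show ?thesis .
qed

lemma finite_S_triangle_values: "finite {S_triangle P | P. finite P \<and> card P = n}"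
  by (rule finite_subset[of _ "{..n choose 3}"]) (auto dest: S_triangle_le_choose)

lemma S_triangle_values_nonempty: "{S_triangle P | P. finite P \<and> card P = n} \<noteq> {}"
proof -
  have "infinite (UNIV :: (real ^ 2) set)"
    using finite_imp_bounded not_bounded_UNIV by blast
  then obtain P :: "(real ^ 2) set" where "finite P" "card P = n"
    using infinite_arbitrarily_large by blast
  then show ?thesis by auto
qed

end

theory Submission
  imports Defs
begin

text \<open>
  Place the points in the complex plane so that no two share a real or an imaginary part. Let \<open>N\<close> be
  the number of isosceles right triangles, \<open>R x\<close> the number of those with apex \<open>x\<close> and \<open>M x\<close>,
  \<open>M' x\<close> the numbers of those in which \<open>x\<close> is the vertex of middle height, respectively of middle
  abscissa. Then \<open>6 N = (\<Sum>x. 4 R x + M x + M' x)\<close>. Seen from \<open>x\<close>, the other \<open>m = n - 1\<close> points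
  are grouped into cycles \<open>v, \<i> v, - v, - \<i> v\<close> with one member in each quadrant, and examining a
  cycle shows that the summand is at most
  \<open>2 m + 4 min(above, below) + 4 min(left, right)\<close>. The points closest to and farthest from \<open>x\<close> lack
  partners in triangles having an acute angle at \<open>x\<close>, which saves 4 for all but at most one \<open>x\<close>,
  and 2 for that one. As \<open>x\<close> varies, the number of points above it takes each of the values \<open>0, \<dots>, m\<close>
  once, so each sum of minima is at most \<open>m\<^sup>2 / 4\<close>, and
  \<open>6 N \<le> 2 (m + 1) m + 2 m\<^sup>2 - 4 (m + 1) + 2 \<le> 4 m\<^sup>2 - 10\<close> if \<open>m \<ge> 4\<close>.
\<close>

section \<open>Triangles through a fixed point\<close>

text \<open>Every orbit of the quarter turn on \<open>Y\<close> has one member in each open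
  quadrant, so the orbits are indexed by their members in the first.\<close>

lemma sum_quadrants:
  fixes f :: "complex \<Rightarrow> nat"
  assumes "finite Y" and rot: "\<And>v. v \<in> Y \<Longrightarrow> \<i> * v \<in> Y"
    and axes: "\<And>v. v \<in> Y \<Longrightarrow> Re v \<noteq> 0 \<and> Im v \<noteq> 0"
  shows "sum f Y = (\<Sum>w\<in>{v\<in>Y. Re v > 0 \<and> Im v > 0}. f w + f (\<i> * w) + f (- w) + f (- (\<i> * w)))"
proof -
  define W where "W = {v\<in>Y. Re v > 0 \<and> Im v > 0}"
  have rot2: "- v \<in> Y" if "v \<in> Y" for v
    using rot[OF rot[OF that]] by (simp flip: mult.assoc)
  have W: "finite W" using assms by (simp add: W_def)
  have 2: "{v\<in>Y. Re v < 0 \<and> Im v > 0} = (\<lambda>w. \<i> * w) ` W" (is "?L = _")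
  proof
    show "?L \<subseteq> (\<lambda>w. \<i> * w) ` W"
    proof
      fix v assume v: "v \<in> ?L"
      then have "- (\<i> * v) \<in> W" using rot rot2 by (auto simp: W_def)
      moreover have "v = \<i> * (- (\<i> * v))" by (simp flip: mult.assoc)
      ultimately show "v \<in> (\<lambda>w. \<i> * w) ` W" by blast
    qed
  qed (use rot in \<open>auto simp: W_def\<close>)
  have 3: "{v\<in>Y. Re v < 0 \<and> Im v < 0} = uminus ` W" (is "?L = _")
  proof
    show "?L \<subseteq> uminus ` W"
    proof
      fix v assume v: "v \<in> ?L"
      then have "- v \<in> W" using rot2 by (auto simp: W_def)
      then show "v \<in> uminus ` W" by force
    qed
  qed (use rot2 in \<open>auto simp: W_def\<close>)
  have 4: "{v\<in>Y. Re v > 0 \<and> Im v < 0} = (\<lambda>w. - (\<i> * w)) ` W" (is "?L = _")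
  proof
    show "?L \<subseteq> (\<lambda>w. - (\<i> * w)) ` W"
    proof
      fix v assume v: "v \<in> ?L"
      then have "\<i> * v \<in> W" using rot by (auto simp: W_def)
      moreover have "v = - (\<i> * (\<i> * v))" by (simp flip: mult.assoc)
      ultimately show "v \<in> (\<lambda>w. - (\<i> * w)) ` W" by blast
    qed
  qed (use rot rot2 in \<open>auto simp: W_def\<close>)
  have "Y = (W \<union> (\<lambda>w. \<i> * w) ` W) \<union> (uminus ` W \<union> (\<lambda>w. - (\<i> * w)) ` W)"
    unfolding 2[symmetric] 3[symmetric] 4[symmetric]
    using axes unfolding W_def by (auto simp: not_less le_less)
  then have "sum f Y = sum f ((W \<union> (\<lambda>w. \<i> * w) ` W) \<union> (uminus ` W \<union> (\<lambda>w. - (\<i> * w)) ` W))"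
    by simp
  also have "\<dots> = (sum f W + sum f ((\<lambda>w. \<i> * w) ` W)) + (sum f (uminus ` W) + sum f ((\<lambda>w. - (\<i> * w)) ` W))"
  proof -
    have "finite ((\<lambda>w. \<i> * w) ` W)" "finite (uminus ` W)" "finite ((\<lambda>w. - (\<i> * w)) ` W)"
      using W by simp_all
    moreover have "W \<inter> (\<lambda>w. \<i> * w) ` W = {}" "uminus ` W \<inter> (\<lambda>w. - (\<i> * w)) ` W = {}"
      "(W \<union> (\<lambda>w. \<i> * w) ` W) \<inter> (uminus ` W \<union> (\<lambda>w. - (\<i> * w)) ` W) = {}"
      unfolding 2[symmetric] 3[symmetric] 4[symmetric] by (auto simp: W_def)
    ultimately show ?thesis using W by (simp add: sum.union_disjoint)
  qed
  also have "\<dots> = (\<Sum>w\<in>W. f w + f (\<i> * w) + f (- w) + f (- (\<i> * w)))"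
    by (simp add: sum.reindex inj_on_def sum.distrib)
  finally show ?thesis by (simp add: W_def)
qed

text \<open>For \<open>X\<close> without the origin, \<open>v\<close> stands for the triangle
  \<open>0, v, \<i> v\<close> with right angle at \<open>0\<close>; naming it by the leg that turns
  counterclockwise onto the other counts it once.\<close>

definition quarter_turns :: "complex set \<Rightarrow> complex set" where
  "quarter_turns X = {v\<in>X. \<i> * v \<in> X}"

text \<open>For \<open>k = 1 + \<i>\<close> and \<open>k = 1 - \<i>\<close>, the apexes \<open>v\<close> of triangles \<open>0, v, k v\<close>, right-angled at \<open>v\<close>,
  that have the origin strictly between the other two vertices in the direction picked out by \<open>d\<close>:
  vertical for \<open>d = 1\<close>, horizontal for \<open>d = \<i>\<close>.\<close>
definition acute_middles :: "complex \<Rightarrow> complex set \<Rightarrow> complex \<Rightarrow> complex set" where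
  "acute_middles d X k = {v\<in>X. k * v \<in> X \<and> Im (d * v) * Im (d * (k * v)) < 0}"

lemma norm_one_plus_minus_i:
  "norm ((1 + \<i>) * v) = sqrt 2 * norm v" "norm ((1 - \<i>) * v) = sqrt 2 * norm v"
  unfolding norm_mult by (simp_all add: cmod_def)

text \<open>Each such triangle is charged to its vertex on the side \<open>s\<close> of the line through the origin; that
  vertex lies within 45 degrees of the line. It is charged at most once as the apex, and then it is not
  a farthest point, and at most once as the other acute vertex, and then it is not a closest one.\<close>
lemma acute_middles_le:
  fixes d :: complex and s :: real
  assumes "finite X" and "0 \<notin> X" and s: "s = 1 \<or> s = - 1"
    and bounds: "\<And>v. v \<in> X \<Longrightarrow> lo \<le> norm v \<and> norm v \<le> hi"
  shows "card (acute_middles d X (1 + \<i>)) + card (acute_middles d X (1 - \<i>)) \<le>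
    (\<Sum>v\<in>{v\<in>X. s * Im (d * v) > 0 \<and> \<bar>Im (d * v)\<bar> < \<bar>Re (d * v)\<bar>}.
       of_bool (norm v < hi) + of_bool (lo < norm v))"
proof -
  define E where "E = {v\<in>X. s * Im (d * v) > 0 \<and> \<bar>Im (d * v)\<bar> < \<bar>Re (d * v)\<bar>}"
  \<comment> \<open>An apex on side \<open>s\<close> takes the charge itself; if the apex is on the
    other side, \<open>k * v\<close> is on side \<open>s\<close> and takes it.\<close>
  define up where "up k = {v\<in>acute_middles d X k. s * Im (d * v) > 0}" for k
  define down where "down k = {v\<in>acute_middles d X k. s * Im (d * v) < 0}" for k
  have fin [simp]: "finite (up k)" "finite (down k)" "finite E" for k
    using \<open>finite X\<close> by (auto simp: up_def down_def acute_middles_def E_def)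
  have split: "card (acute_middles d X k) = card (up k) + card (down k)" for k
  proof -
    have "acute_middles d X k = up k \<union> down k"
      using s by (auto simp: up_def down_def acute_middles_def mult_less_0_iff)
    moreover have "up k \<inter> down k = {}" by (auto simp: up_def down_def)
    ultimately show ?thesis by (simp add: card_Un_disjoint)
  qed
  have grow: "norm v < sqrt 2 * norm v" if "v \<in> X" for v
    using that \<open>0 \<notin> X\<close> by (metis less_eq_real_def mult_less_cancel_right1 norm_ge_zero
      norm_eq_zero not_less real_sqrt_gt_1_iff one_less_numeral_iff semiring_norm(76))
  have coord: "Im (d * ((1 + \<i>) * v)) = Im (d * v) + Re (d * v)"
    "Re (d * ((1 + \<i>) * v)) = Re (d * v) - Im (d * v)"
    "Im (d * ((1 - \<i>) * v)) = Im (d * v) - Re (d * v)"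
    "Re (d * ((1 - \<i>) * v)) = Re (d * v) + Im (d * v)" for v
    by (simp_all add: algebra_simps)
  \<comment> \<open>Here \<open>b\<close> and \<open>a\<close> are \<open>Im (d * v)\<close> and
    \<open>Re (d * v)\<close>. Opposite signs at \<open>v\<close> and \<open>k * v\<close> put both
    vertices within 45 degrees of the line, hence the charged one in \<open>E\<close>.\<close>
  have opp1: "\<bar>b\<bar> < \<bar>a\<bar> \<and> \<bar>b + a\<bar> < \<bar>a - b\<bar>" if "b * (b + a) < 0" for a b :: real
    using that by (auto simp: mult_less_0_iff)
  have opp2: "\<bar>b\<bar> < \<bar>a\<bar> \<and> \<bar>b - a\<bar> < \<bar>a + b\<bar>" if "b * (b - a) < 0" for a b :: real
    using that by (auto simp: mult_less_0_iff)
  have "card (up (1 + \<i>)) + card (up (1 - \<i>)) = card (up (1 + \<i>) \<union> up (1 - \<i>))"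
  proof (rule card_Un_disjoint[symmetric])
    \<comment> \<open>The values \<open>b + a\<close> and \<open>b - a\<close> average to
      \<open>b\<close>, so they cannot both have the sign opposite to it.\<close>
    have "\<not> (b * (b + a) < 0 \<and> b * (b - a) < 0)" for a b :: real
      by (auto simp: mult_less_0_iff)
    then show "up (1 + \<i>) \<inter> up (1 - \<i>) = {}"
      unfolding up_def acute_middles_def coord by blast
  qed simp_all
  also have "\<dots> \<le> card {v\<in>E. norm v < hi}"
  proof (rule card_mono)
    have "norm v < hi" if "v \<in> X" "(1 + \<i>) * v \<in> X \<or> (1 - \<i>) * v \<in> X" for v
      using that bounds grow norm_one_plus_minus_i by (metis less_le_trans)
    then show "up (1 + \<i>) \<union> up (1 - \<i>) \<subseteq> {v\<in>E. norm v < hi}"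
      using opp1 opp2 unfolding up_def acute_middles_def E_def coord by blast
  qed simp
  finally have 1: "card (up (1 + \<i>)) + card (up (1 - \<i>)) \<le> card {v\<in>E. norm v < hi}" .
  have inj: "inj_on ((*) (1 + \<i>)) A" "inj_on ((*) (1 - \<i>)) A" for A
    by (auto simp: inj_on_def complex_eq_iff)
  have "card (down (1 + \<i>)) + card (down (1 - \<i>)) =
      card ((*) (1 + \<i>) ` down (1 + \<i>)) + card ((*) (1 - \<i>) ` down (1 - \<i>))"
    by (simp add: card_image inj)
  also have "\<dots> = card ((*) (1 + \<i>) ` down (1 + \<i>) \<union> (*) (1 - \<i>) ` down (1 - \<i>))"
  proof (rule card_Un_disjoint[symmetric])
    \<comment> \<open>A shared third vertex is \<open>v + w\<close>, the corner opposite the origin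
      of a square; it cannot lie on the other side of the line from both \<open>v\<close> and
      \<open>w\<close>.\<close>
    have False if v: "v \<in> down (1 + \<i>)" and w: "w \<in> down (1 - \<i>)"
      and eq: "(1 + \<i>) * v = (1 - \<i>) * w" for v w
    proof -
      have "v + w = (1 + \<i>) * v"
        using eq by (auto simp: complex_eq_iff algebra_simps)
      then have "Im (d * v) + Im (d * w) = Im (d * ((1 + \<i>) * v))"
        by (metis distrib_left plus_complex.simps(2))
      moreover have "Im (d * v) * Im (d * ((1 + \<i>) * v)) < 0" "s * Im (d * v) < 0" "s * Im (d * w) < 0"
        using v w by (auto simp: down_def acute_middles_def)
      ultimately show False using s by (auto simp: mult_less_0_iff)
    qed
    then show "(*) (1 + \<i>) ` down (1 + \<i>) \<inter> (*) (1 - \<i>) ` down (1 - \<i>) = {}" by auto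
  qed auto
  also have "\<dots> \<le> card {v\<in>E. lo < norm v}"
  proof (rule card_mono)
    have lo: "lo < norm ((1 + \<i>) * v)" "lo < norm ((1 - \<i>) * v)" if "v \<in> X" for v
      using bounds[OF that] grow[OF that] unfolding norm_one_plus_minus_i by linarith+
    have "(1 + \<i>) * v \<in> {v\<in>E. lo < norm v}" if "v \<in> down (1 + \<i>)" for v
      using that opp1[of "Im (d * v)" "Re (d * v)"] s lo
      unfolding down_def acute_middles_def E_def mem_Collect_eq coord
      by (auto simp: mult_less_0_iff)
    moreover have "(1 - \<i>) * v \<in> {v\<in>E. lo < norm v}" if "v \<in> down (1 - \<i>)" for v
      using that opp2[of "Im (d * v)" "Re (d * v)"] s lo
      unfolding down_def acute_middles_def E_def mem_Collect_eq coord
      by (auto simp: mult_less_0_iff)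
    ultimately show "(*) (1 + \<i>) ` down (1 + \<i>) \<union> (*) (1 - \<i>) ` down (1 - \<i>) \<subseteq> {v\<in>E. lo < norm v}"
      by blast
  qed simp
  finally have 2: "card (down (1 + \<i>)) + card (down (1 - \<i>)) \<le> card {v\<in>E. lo < norm v}" .
  have "(\<Sum>v\<in>E. of_bool (norm v < hi) + of_bool (lo < norm v)) =
      card {v\<in>E. norm v < hi} + card {v\<in>E. lo < norm v}"
    by (simp add: sum.distrib sum_of_bool_eq Int_def)
  then show ?thesis using 1 2 by (simp add: split E_def)
qed

text \<open>The Booleans tell which of \<open>w, \<i> w, - w, - \<i> w\<close>, where \<open>w = a + \<i> b\<close>, are present; \<open>c\<close> is the charge
  that a point may receive, and \<open>s\<close>, \<open>t\<close> point to the smaller half plane for either axis.\<close>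
lemma cycle_inequality:
  fixes x1 x2 x3 x4 :: bool and c :: nat and a b s t :: real
  assumes "a > 0" "b > 0" "s = 1 \<or> s = - 1" "t = 1 \<or> t = - 1" "c \<le> 2" "x1 \<or> x2 \<or> x3 \<or> x4"
  defines "wt \<equiv> \<lambda>(u::real) v. of_bool (s * v > 0 \<and> \<bar>v\<bar> < \<bar>u\<bar>) * c + of_bool (t * u > 0 \<and> \<bar>u\<bar> < \<bar>v\<bar>) * c"
    and "cap \<equiv> \<lambda>(u::real) v. (2::nat) + 4 * of_bool (s * v > 0) + 4 * of_bool (t * u > 0)"
  shows "of_bool x1 * (5 * of_bool x2 + wt a b) + of_bool x2 * (5 * of_bool x3 + wt (- b) a) +
      of_bool x3 * (5 * of_bool x4 + wt (- a) (- b)) + of_bool x4 * (5 * of_bool x1 + wt b (- a)) +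
      2 * of_bool (c \<le> 1)
    \<le> of_bool x1 * cap a b + of_bool x2 * cap (- b) a + of_bool x3 * cap (- a) (- b) + of_bool x4 * cap b (- a)"
proof -
  \<comment> \<open>The order of \<open>a\<close> and \<open>b\<close> settles which charges in
    \<open>wt\<close> are active, leaving a finite check over signs and occupied positions.\<close>
  consider "a < b" | "a = b" | "b < a" by linarith
  then show ?thesis
    using assms(1-6) unfolding wt_def cap_def
    by cases (cases x1; cases x2; cases x3; cases x4; auto simp: of_bool_def)+
qed


text \<open>This sums \<open>cycle_inequality\<close> over all cycles. A triangle with apex at the
  origin weighs 5: 4 as apex, and 1 because the origin is its middle vertex in one of the two
  directions.\<close>

lemma local_count:
  fixes X :: "complex set"
  assumes "finite X" "X \<noteq> {}" and axes: "\<And>v. v \<in> X \<Longrightarrow> Re v \<noteq> 0 \<and> Im v \<noteq> 0"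
  shows "5 * card (quarter_turns X) +
      (card (acute_middles 1 X (1 + \<i>)) + card (acute_middles 1 X (1 - \<i>))) +
      (card (acute_middles \<i> X (1 + \<i>)) + card (acute_middles \<i> X (1 - \<i>))) +
      2 * card {Min (norm ` X), Max (norm ` X)}
    \<le> 2 * card X + 4 * min (card {v\<in>X. Im v > 0}) (card {v\<in>X. Im v < 0}) +
       4 * min (card {v\<in>X. Re v > 0}) (card {v\<in>X. Re v < 0})"
proof -
  define lo hi where "lo = Min (norm ` X)" and "hi = Max (norm ` X)"
  define c :: "complex \<Rightarrow> nat" where "c v = of_bool (norm v < hi) + of_bool (lo < norm v)" for v
  obtain s :: real where s: "s = 1 \<or> s = - 1"
    and s_min: "min (card {v\<in>X. Im v > 0}) (card {v\<in>X. Im v < 0}) = card {v\<in>X. s * Im v > 0}"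
  proof (cases "card {v\<in>X. Im v > 0} \<le> card {v\<in>X. Im v < 0}")
    case True
    then show ?thesis using that[of 1] by simp
  next
    case False
    then show ?thesis using that[of "-1"] by simp
  qed
  obtain t :: real where t: "t = 1 \<or> t = - 1"
    and t_min: "min (card {v\<in>X. Re v > 0}) (card {v\<in>X. Re v < 0}) = card {v\<in>X. t * Re v > 0}"
  proof (cases "card {v\<in>X. Re v > 0} \<le> card {v\<in>X. Re v < 0}")
    case True
    then show ?thesis using that[of 1] by simp
  next
    case False
    then show ?thesis using that[of "-1"] by simp
  qed
  have bounds: "lo \<le> norm v \<and> norm v \<le> hi" if "v \<in> X" for v
    using that \<open>finite X\<close> by (simp add: lo_def hi_def)
  have zero: "0 \<notin> X" using axes by force
  define wt where "wt u v k =
    of_bool (s * v > 0 \<and> \<bar>v\<bar> < \<bar>u\<bar>) * k + of_bool (t * u > 0 \<and> \<bar>u\<bar> < \<bar>v\<bar>) * k"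
    for u v :: real and k :: nat
  define cap where "cap u v = (2::nat) + 4 * of_bool (s * v > 0) + 4 * of_bool (t * u > 0)" for u v :: real
  define f where "f v = of_bool (v \<in> X) * (5 * of_bool (\<i> * v \<in> X) + wt (Re v) (Im v) (c v))" for v
  define g where "g v = of_bool (v \<in> X) * cap (Re v) (Im v)" for v
  \<comment> \<open>Completing \<open>X\<close> to whole cycles, with membership in \<open>X\<close>
    kept as an indicator in \<open>f\<close> and \<open>g\<close>, allows a comparison cycle by
    cycle.\<close>
  define Y where "Y = X \<union> (\<lambda>v. \<i> * v) ` X \<union> uminus ` X \<union> (\<lambda>v. - (\<i> * v)) ` X"
  define W where "W = {v\<in>Y. Re v > 0 \<and> Im v > 0}"
  have "finite Y" using \<open>finite X\<close> by (simp add: Y_def)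
  have Y_rot: "\<i> * v \<in> Y" if "v \<in> Y" for v
    using that unfolding Y_def by (auto simp flip: mult.assoc)
  have Y_axes: "Re v \<noteq> 0 \<and> Im v \<noteq> 0" if "v \<in> Y" for v
    using that axes unfolding Y_def by auto
  have Y_X: "w \<in> X \<or> \<i> * w \<in> X \<or> - w \<in> X \<or> - (\<i> * w) \<in> X" if "w \<in> Y" for w
    using that unfolding Y_def by (auto simp flip: mult.assoc)
  have XY: "sum h X = (\<Sum>v\<in>Y. of_bool (v \<in> X) * h v)" for h :: "complex \<Rightarrow> nat"
  proof -
    have "Y \<inter> X = X" by (auto simp: Y_def)
    then show ?thesis using \<open>finite Y\<close> by simp
  qed
  have "card (acute_middles 1 X (1 + \<i>)) + card (acute_middles 1 X (1 - \<i>)) \<le>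
      (\<Sum>v\<in>X. of_bool (s * Im v > 0 \<and> \<bar>Im v\<bar> < \<bar>Re v\<bar>) * c v)"
    using acute_middles_le[of X s lo hi 1] \<open>finite X\<close> zero s bounds
    by (simp add: Int_def c_def)
  moreover have "card (acute_middles \<i> X (1 + \<i>)) + card (acute_middles \<i> X (1 - \<i>)) \<le>
      (\<Sum>v\<in>X. of_bool (t * Re v > 0 \<and> \<bar>Re v\<bar> < \<bar>Im v\<bar>) * c v)"
    using acute_middles_le[of X t lo hi \<i>] \<open>finite X\<close> zero t bounds
    by (simp add: Int_def c_def)
  moreover have "card (quarter_turns X) = (\<Sum>v\<in>X. of_bool (\<i> * v \<in> X))"
    using \<open>finite X\<close> by (simp add: quarter_turns_def sum_of_bool_eq Int_def)
  moreover have "sum f Y = 5 * (\<Sum>v\<in>X. of_bool (\<i> * v \<in> X)) +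
      (\<Sum>v\<in>X. of_bool (s * Im v > 0 \<and> \<bar>Im v\<bar> < \<bar>Re v\<bar>) * c v) +
      (\<Sum>v\<in>X. of_bool (t * Re v > 0 \<and> \<bar>Re v\<bar> < \<bar>Im v\<bar>) * c v)"
    unfolding f_def wt_def XY[symmetric] sum.distrib by (simp add: sum_distrib_left)
  ultimately have lhs: "5 * card (quarter_turns X) +
      (card (acute_middles 1 X (1 + \<i>)) + card (acute_middles 1 X (1 - \<i>))) +
      (card (acute_middles \<i> X (1 + \<i>)) + card (acute_middles \<i> X (1 - \<i>))) \<le> sum f Y"
    by linarith
  have "sum g Y = 2 * card X + 4 * (\<Sum>v\<in>X. of_bool (s * Im v > 0)) + 4 * (\<Sum>v\<in>X. of_bool (t * Re v > 0))"
    unfolding g_def cap_def XY[symmetric] sum.distrib by (simp add: sum_distrib_left)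
  then have rhs: "sum g Y = 2 * card X + 4 * card {v\<in>X. s * Im v > 0} + 4 * card {v\<in>X. t * Re v > 0}"
    using \<open>finite X\<close> by (simp add: sum_of_bool_eq Int_def)
  have "(f w + f (\<i> * w) + f (- w) + f (- (\<i> * w))) + 2 * of_bool (c w \<le> 1)
      \<le> g w + g (\<i> * w) + g (- w) + g (- (\<i> * w))" if "w \<in> W" for w
  proof -
    have c_rot: "c (\<i> * w) = c w" "c (- w) = c w" "c (- (\<i> * w)) = c w"
      by (simp_all add: c_def norm_mult)
    have rot: "\<i> * (\<i> * w) = - w" "\<i> * - w = - (\<i> * w)" "\<i> * (- (\<i> * w)) = w"
      by (simp_all flip: mult.assoc)
    have "c w \<le> 2" by (simp add: c_def)
    then show ?thesis
      using cycle_inequality[of "Re w" "Im w" s t "c w" "w \<in> X" "\<i> * w \<in> X" "- w \<in> X" "- (\<i> * w) \<in> X"]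
        s t Y_X[of w] that
      unfolding f_def g_def wt_def cap_def c_rot rot W_def by simp
  qed
  then have "(\<Sum>w\<in>W. (f w + f (\<i> * w) + f (- w) + f (- (\<i> * w))) + 2 * of_bool (c w \<le> 1))
      \<le> (\<Sum>w\<in>W. g w + g (\<i> * w) + g (- w) + g (- (\<i> * w)))"
    by (rule sum_mono)
  moreover have "sum h Y = (\<Sum>w\<in>W. h w + h (\<i> * w) + h (- w) + h (- (\<i> * w)))"
    for h :: "complex \<Rightarrow> nat"
    unfolding W_def using \<open>finite Y\<close> Y_rot Y_axes by (rule sum_quadrants)
  ultimately have "sum f Y + 2 * (\<Sum>w\<in>W. of_bool (c w \<le> 1)) \<le> sum g Y"
    by (simp add: sum.distrib sum_distrib_left)
  \<comment> \<open>At an extreme norm \<open>c\<close> is at most 1. The norm is constant on a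
    cycle, so distinct extreme norms come from distinct cycles, each with a slack of 2.\<close>
  moreover have "card {lo, hi} \<le> (\<Sum>w\<in>W. of_bool (c w \<le> 1))"
  proof -
    have "finite W" using \<open>finite Y\<close> by (simp add: W_def)
    have W_rep: "norm v \<in> norm ` {w\<in>W. c w \<le> 1}" if v: "v \<in> X" "norm v \<in> {lo, hi}" for v
    proof -
      have "v \<in> Y" using v by (simp add: Y_def)
      moreover have "- v \<in> Y" "\<i> * v \<in> Y" "- (\<i> * v) \<in> Y" using v by (auto simp: Y_def)
      ultimately have "v \<in> W \<or> - v \<in> W \<or> \<i> * v \<in> W \<or> - (\<i> * v) \<in> W"
        using Y_axes[of v] by (auto simp: W_def)
      then obtain w where w: "w \<in> W" "norm w = norm v" by (metis norm_minus_cancel norm_mult norm_ii mult_1)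
      moreover have "c w \<le> 1" using v(2) w(2) by (auto simp: c_def)
      ultimately show ?thesis by (metis (mono_tags, lifting) imageI mem_Collect_eq)
    qed
    have "lo \<in> norm ` X" "hi \<in> norm ` X"
      using \<open>finite X\<close> \<open>X \<noteq> {}\<close> by (simp_all add: lo_def hi_def)
    then have "{lo, hi} \<subseteq> norm ` {w\<in>W. c w \<le> 1}" using W_rep by auto
    then have "card {lo, hi} \<le> card (norm ` {w\<in>W. c w \<le> 1})"
      using \<open>finite W\<close> by (intro card_mono) auto
    also have "\<dots> \<le> card {w\<in>W. c w \<le> 1}" using \<open>finite W\<close> by (intro card_image_le) auto
    also have "\<dots> = (\<Sum>w\<in>W. of_bool (c w \<le> 1))"
      using \<open>finite W\<close> by (simp add: sum_of_bool_eq Int_def)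
    finally show ?thesis .
  qed
  ultimately show ?thesis
    using lhs rhs s_min t_min by (simp add: lo_def hi_def)
qed


section \<open>Counting triangles by apex and by middle vertex\<close>

definition seen_from :: "complex \<Rightarrow> complex set \<Rightarrow> complex set" where
  "seen_from x Q = (\<lambda>y. y - x) ` (Q - {x})"

lemma mem_seen_from: "v \<in> seen_from x Q \<longleftrightarrow> v \<noteq> 0 \<and> x + v \<in> Q"
proof -
  have "v \<in> seen_from x Q" if "v \<noteq> 0" "x + v \<in> Q"
    unfolding seen_from_def using that by (intro image_eqI[of _ _ "x + v"]) auto
  then show ?thesis by (auto simp: seen_from_def)
qed

lemma finite_seen_from: "finite Q \<Longrightarrow> finite (seen_from x Q)"
  by (simp add: seen_from_def)

lemma card_seen_from_Collect:
  "card {v \<in> seen_from x Q. R v} = card {y\<in>Q. y \<noteq> x \<and> R (y - x)}"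
proof -
  have "{v \<in> seen_from x Q. R v} = (\<lambda>y. y - x) ` {y\<in>Q. y \<noteq> x \<and> R (y - x)}"
    by (auto simp: seen_from_def)
  then show ?thesis by (simp add: card_image inj_on_def)
qed

text \<open>The pair \<open>(a, b)\<close> encodes the triangle with apex \<open>a\<close> whose legs run, counterclockwise,
  to \<open>b\<close> and to \<open>a + \<i> * (b - a)\<close>.\<close>
definition right_triangles :: "complex set \<Rightarrow> (complex \<times> complex) set" where
  "right_triangles Q = {(a, b). a \<in> Q \<and> b \<in> Q \<and> a \<noteq> b \<and> a + \<i> * (b - a) \<in> Q}"

lemma finite_right_triangles: "finite Q \<Longrightarrow> finite (right_triangles Q)"
  by (rule finite_subset[of _ "Q \<times> Q"]) (auto simp: right_triangles_def)

lemma card_le_sum_image_Sigma: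
  assumes "finite Q" "\<And>x. x \<in> Q \<Longrightarrow> finite (A x)" "T \<subseteq> f ` Sigma Q A"
  shows "card T \<le> (\<Sum>x\<in>Q. card (A x))"
proof -
  have "finite (Sigma Q A)" using assms(1,2) by (rule finite_SigmaI)
  then have "card T \<le> card (Sigma Q A)"
    using assms(3) by (meson card_image_le card_mono finite_imageI le_trans)
  then show ?thesis using assms by simp
qed

lemma card_right_triangles_le_apex:
  assumes "finite Q"
  shows "card (right_triangles Q) \<le> (\<Sum>x\<in>Q. card (quarter_turns (seen_from x Q)))"
proof (rule card_le_sum_image_Sigma[where f = "\<lambda>(x, v). (x, x + v)"])
  show "right_triangles Q \<subseteq> (\<lambda>(x, v). (x, x + v)) ` (SIGMA x:Q. quarter_turns (seen_from x Q))"
  proof clarify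
    fix a b assume "(a, b) \<in> right_triangles Q"
    then show "(a, b) \<in> (\<lambda>(x, v). (x, x + v)) ` (SIGMA x:Q. quarter_turns (seen_from x Q))"
      by (intro image_eqI[of _ _ "(a, b - a)"])
        (auto simp: right_triangles_def quarter_turns_def mem_seen_from)
  qed
qed (use assms in \<open>auto simp: quarter_turns_def finite_seen_from\<close>)

text \<open>As \<open>Im (d * z)\<close> separates the points, every triangle has a strictly middle
  vertex. Seen from it, the other two form a quarter turn if it is the apex, and otherwise are
  \<open>v\<close> and \<open>(1 + \<i>) * v\<close> or \<open>(1 - \<i>) * v\<close>.\<close>

lemma card_right_triangles_le_middle:
  assumes "finite Q" and inj: "inj_on (\<lambda>z. Im (d * z)) Q"
  shows "card (right_triangles Q) \<le>
    (\<Sum>x\<in>Q. card {v \<in> quarter_turns (seen_from x Q). Im (d * v) * Im (d * (\<i> * v)) < 0} +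
      (card (acute_middles d (seen_from x Q) (1 + \<i>)) + card (acute_middles d (seen_from x Q) (1 - \<i>))))"
proof -
  define h where "h z = Im (d * z)" for z
  define A where "A x = {v \<in> quarter_turns (seen_from x Q). h v * h (\<i> * v) < 0}" for x
  define B where "B k x = acute_middles d (seen_from x Q) k" for k x
  have B_iff: "v \<in> B k x \<longleftrightarrow> v \<in> seen_from x Q \<and> k * v \<in> seen_from x Q \<and> h v * h (k * v) < 0"
    for v k x by (simp add: B_def acute_middles_def h_def)
  have h_add: "h (y + z) = h y + h z" "h (y - z) = h y - h z" for y z
    by (simp_all add: h_def algebra_simps)
  \<comment> \<open>\<open>TA\<close>, \<open>TB\<close> and \<open>TC\<close> collect the triangles
    whose middle vertex is the apex \<open>a\<close>, the vertex \<open>b\<close> and the third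
    vertex, respectively.\<close>
  define TA where "TA = {(a, b) \<in> right_triangles Q. h (b - a) * h (\<i> * (b - a)) < 0}"
  define TB where "TB = {(a, b) \<in> right_triangles Q. h (a - b) * h ((1 - \<i>) * (a - b)) < 0}"
  define TC where "TC = {(a, b) \<in> right_triangles Q. h (- (\<i> * (b - a))) * h ((1 + \<i>) * - (\<i> * (b - a))) < 0}"
  have "right_triangles Q \<subseteq> TA \<union> TB \<union> TC"
  proof clarify
    fix a b assume ab: "(a, b) \<in> right_triangles Q" "(a, b) \<notin> TC" "(a, b) \<notin> TB"
    define c where "c = a + \<i> * (b - a)"
    have Q: "a \<in> Q" "b \<in> Q" "c \<in> Q" "a \<noteq> b"
      using ab by (auto simp: right_triangles_def c_def)
    have "a \<noteq> c" "b \<noteq> c" using \<open>a \<noteq> b\<close> by (auto simp: c_def complex_eq_iff)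
    then have ne: "h a \<noteq> h b" "h a \<noteq> h c" "h b \<noteq> h c"
      using Q inj unfolding h_def inj_on_def by blast+
    have c: "\<i> * (b - a) = c - a" "(1 - \<i>) * (a - b) = c - b" "(1 + \<i>) * - (c - a) = b - c"
      by (auto simp: c_def complex_eq_iff)
    have "\<not> h (- (c - a)) * h (b - c) < 0" "\<not> h (a - b) * h (c - b) < 0"
      using ab unfolding TB_def TC_def mem_Collect_eq prod.case c by blast+
    then have "\<not> h (a - c) * h (b - c) < 0" "\<not> h (a - b) * h (c - b) < 0"
      by simp_all
    then have "h (b - a) * h (c - a) < 0"
      using ne unfolding h_add by (auto simp: mult_less_0_iff)
    then show "(a, b) \<in> TA" using ab(1) unfolding TA_def mem_Collect_eq prod.case c by blast
  qed
  then have "card (right_triangles Q) \<le> card (TA \<union> TB \<union> TC)"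
    by (intro card_mono finite_subset[OF _ finite_right_triangles[OF \<open>finite Q\<close>]])
      (auto simp: TA_def TB_def TC_def)
  also have "\<dots> \<le> card TA + card TB + card TC"
    by (meson add_le_mono1 card_Un_le le_trans)
  finally have "card (right_triangles Q) \<le> card TA + card TB + card TC" .
  moreover have "card TA \<le> (\<Sum>x\<in>Q. card (A x))"
  proof (rule card_le_sum_image_Sigma[where f = "\<lambda>(x, v). (x, x + v)"])
    show "TA \<subseteq> (\<lambda>(x, v). (x, x + v)) ` Sigma Q A"
    proof clarify
      fix a b assume "(a, b) \<in> TA"
      then show "(a, b) \<in> (\<lambda>(x, v). (x, x + v)) ` Sigma Q A"
        by (intro image_eqI[of _ _ "(a, b - a)"])
          (auto simp: TA_def A_def right_triangles_def quarter_turns_def mem_seen_from)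
    qed
  qed (use \<open>finite Q\<close> in \<open>auto simp: A_def quarter_turns_def finite_seen_from\<close>)
  moreover have "card TB \<le> (\<Sum>x\<in>Q. card (B (1 - \<i>) x))"
  proof (rule card_le_sum_image_Sigma[where f = "\<lambda>(x, v). (x + v, x)"])
    show "TB \<subseteq> (\<lambda>(x, v). (x + v, x)) ` Sigma Q (B (1 - \<i>))"
    proof clarify
      fix a b assume ab: "(a, b) \<in> TB"
      have "b + (1 - \<i>) * (a - b) = a + \<i> * (b - a)" by (simp add: algebra_simps)
      then have "a \<noteq> b" "a \<in> Q" "b \<in> Q" "b + (1 - \<i>) * (a - b) \<in> Q"
        and "h (a - b) * h ((1 - \<i>) * (a - b)) < 0"
        using ab unfolding TB_def by (simp_all add: right_triangles_def)
      moreover have "1 - \<i> \<noteq> 0" by (auto simp: complex_eq_iff)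
      ultimately have "a - b \<in> B (1 - \<i>) b"
        by (simp add: B_iff mem_seen_from)
      then show "(a, b) \<in> (\<lambda>(x, v). (x + v, x)) ` Sigma Q (B (1 - \<i>))"
        using \<open>b \<in> Q\<close> by (intro image_eqI[of _ _ "(b, a - b)"]) auto
    qed
  qed (use \<open>finite Q\<close> in \<open>auto simp: B_def acute_middles_def finite_seen_from\<close>)
  moreover have "card TC \<le> (\<Sum>x\<in>Q. card (B (1 + \<i>) x))"
  proof (rule card_le_sum_image_Sigma[where f = "\<lambda>(x, v). (x + v, x + (1 + \<i>) * v)"])
    show "TC \<subseteq> (\<lambda>(x, v). (x + v, x + (1 + \<i>) * v)) ` Sigma Q (B (1 + \<i>))"
    proof clarify
      fix a b assume ab: "(a, b) \<in> TC"
      define c where "c = a + \<i> * (b - a)"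
      have v: "- (\<i> * (b - a)) = a - c" and b: "c + (1 + \<i>) * (a - c) = b"
        by (auto simp: c_def complex_eq_iff)
      have "a \<noteq> b" "a \<in> Q" "b \<in> Q" "c \<in> Q"
        and opp: "h (a - c) * h ((1 + \<i>) * (a - c)) < 0"
        using ab unfolding TC_def v by (auto simp: right_triangles_def c_def)
      moreover have "a \<noteq> c" "1 + \<i> \<noteq> 0" using \<open>a \<noteq> b\<close> by (auto simp: c_def complex_eq_iff)
      ultimately have "a - c \<in> B (1 + \<i>) c"
        by (simp add: B_iff mem_seen_from b)
      then show "(a, b) \<in> (\<lambda>(x, v). (x + v, x + (1 + \<i>) * v)) ` Sigma Q (B (1 + \<i>))"
        using \<open>c \<in> Q\<close> b by (intro image_eqI[of _ _ "(c, a - c)"]) auto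
    qed
  qed (use \<open>finite Q\<close> in \<open>auto simp: B_def acute_middles_def finite_seen_from\<close>)
  ultimately show ?thesis unfolding A_def B_def h_def sum.distrib by linarith
qed

section \<open>Ranks along one coordinate\<close>

text \<open>For \<open>n = k + 2\<close> both end terms vanish, and lowering each of the other
  \<open>k\<close> terms by 1 gives the sum for \<open>k\<close>; for positive \<open>k\<close>,
  \<open>(k - 1)^2 + 4 k = (k + 1)^2\<close>.\<close>

lemma sum_min_rank: "4 * (\<Sum>i<n. min i (n - 1 - i)) \<le> (n - 1 :: nat)\<^sup>2"
proof (induction n rule: less_induct)
  case (less n)
  consider "n = 0" | "n = 1" | k where "n = Suc (Suc k)"
    by (metis One_nat_def not0_implies_Suc)
  then show ?case
  proof cases
    case 3
    have "(\<Sum>i<n. min i (n - 1 - i)) = (\<Sum>i<Suc k. min i (Suc k - i))"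
      unfolding 3 by simp
    also have "\<dots> = (\<Sum>i<k. min (Suc i) (k - i))"
      unfolding sum.lessThan_Suc_shift by simp
    also have "\<dots> = (\<Sum>i<k. min i (k - 1 - i) + 1)"
      by (intro sum.cong) auto
    also have "\<dots> = (\<Sum>i<k. min i (k - 1 - i)) + k"
      unfolding sum.distrib by simp
    finally show ?thesis
      using less.IH[of k] 3 by (cases k) (auto simp: power2_eq_square)
  qed auto
qed

text \<open>The number of points below takes each value from \<open>0\<close> to
  \<open>card Q - 1\<close> once, and the number above is its complement, which reduces the sum to
  \<open>sum_min_rank\<close>.\<close>

lemma sum_min_above_below:
  fixes h :: "'a \<Rightarrow> real"
  assumes "finite Q" "inj_on h Q"
  shows "4 * (\<Sum>x\<in>Q. min (card {y\<in>Q. h y > h x}) (card {y\<in>Q. h y < h x})) \<le> (card Q - 1)\<^sup>2"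
proof -
  define r where "r x = card {y\<in>Q. h y < h x}" for x
  have r_less: "r x < r y" if "x \<in> Q" "h x < h y" for x y
    unfolding r_def using assms(1) that by (intro psubset_card_mono) auto
  have "inj_on r Q"
  proof (rule inj_onI)
    fix x y assume "x \<in> Q" "y \<in> Q" "r x = r y"
    then have "h x = h y" using r_less[of x y] r_less[of y x] by (cases "h x" "h y" rule: linorder_cases) auto
    then show "x = y" using \<open>x \<in> Q\<close> \<open>y \<in> Q\<close> assms(2) by (simp add: inj_on_def)
  qed
  have above: "card {y\<in>Q. h y > h x} = card Q - 1 - r x" and below: "r x < card Q" if "x \<in> Q" for x
  proof -
    have "Q = insert x ({y\<in>Q. h y > h x} \<union> {y\<in>Q. h y < h x})"
      using that assms(2) by (auto simp: inj_on_def dest: linorder_neqE)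
    moreover have "card (insert x ({y\<in>Q. h y > h x} \<union> {y\<in>Q. h y < h x})) = Suc (card {y\<in>Q. h y > h x} + r x)"
      using assms(1) unfolding r_def
      by (subst card_insert_disjoint) (auto intro!: card_Un_disjoint)
    ultimately have "card Q = Suc (card {y\<in>Q. h y > h x} + r x)" by simp
    then show "card {y\<in>Q. h y > h x} = card Q - 1 - r x" "r x < card Q" by simp_all
  qed
  have "r ` Q = {..<card Q}"
    by (rule card_subset_eq) (use below \<open>inj_on r Q\<close> in \<open>auto simp: card_image\<close>)
  have "(\<Sum>x\<in>Q. min (card {y\<in>Q. h y > h x}) (card {y\<in>Q. h y < h x})) =
      (\<Sum>x\<in>Q. min (r x) (card Q - 1 - r x))"
    by (rule sum.cong) (simp_all add: above min.commute flip: r_def)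
  also have "\<dots> = (\<Sum>i<card Q. min i (card Q - 1 - i))"
    using sum.reindex[OF \<open>inj_on r Q\<close>, of "\<lambda>i. min i (card Q - 1 - i)"] \<open>r ` Q = _\<close> by simp
  finally show ?thesis using sum_min_rank[of "card Q"] by simp
qed

text \<open>Two such centres share a radius, namely their distance. Once they are moved to 0 and 1,
  all other points lie on two unit circles, which meet in only two points, so \<open>Q\<close> would
  have at most 4 points.\<close>

lemma equidistant_centre_unique:
  fixes Q :: "complex set"
  assumes "finite Q" "card Q \<ge> 5" "x \<in> Q" "x' \<in> Q"
    and eq: "\<And>y. y \<in> Q \<Longrightarrow> y \<noteq> x \<Longrightarrow> norm (y - x) = r"
    and eq': "\<And>y. y \<in> Q \<Longrightarrow> y \<noteq> x' \<Longrightarrow> norm (y - x') = r'"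
  shows "x = x'"
proof (rule ccontr)
  assume "x \<noteq> x'"
  define g where "g y = (y - x) / (x' - x)" for y
  define B where "B = {Complex (1/2) (sqrt 3 / 2), Complex (1/2) (- sqrt 3 / 2)}"
  have r: "norm (x' - x) = r" "r' = r" "r \<noteq> 0"
    using eq[of x'] eq'[of x] assms(3,4) \<open>x \<noteq> x'\<close> by (auto simp: norm_minus_commute)
  have "g ` (Q - {x, x'}) \<subseteq> B"
  proof (rule image_subsetI)
    fix y assume "y \<in> Q - {x, x'}"
    then have y: "y \<in> Q" "y \<noteq> x" "y \<noteq> x'" by auto
    have "norm (g y) = 1" using eq[of y] y r by (simp add: g_def norm_divide)
    moreover have "norm (g y - 1) = 1"
    proof -
      have "g y - 1 = (y - x') / (x' - x)" using \<open>x \<noteq> x'\<close> by (simp add: g_def field_simps)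
      then show ?thesis using eq'[of y] y r by (simp add: norm_divide)
    qed
    ultimately have 1: "(Re (g y))\<^sup>2 + (Im (g y))\<^sup>2 = 1" "(Re (g y) - 1)\<^sup>2 + (Im (g y))\<^sup>2 = 1"
      by (auto simp: cmod_def)
    then have "Re (g y) = 1/2" by (simp add: power2_eq_square algebra_simps)
    moreover have "(Im (g y))\<^sup>2 = (sqrt 3 / 2)\<^sup>2"
      using 1(1) unfolding \<open>Re (g y) = 1/2\<close> by (simp add: power_divide)
    then have "Im (g y) = sqrt 3 / 2 \<or> Im (g y) = - sqrt 3 / 2" by (simp add: power2_eq_iff)
    ultimately show "g y \<in> B" by (auto simp: B_def complex_eq_iff)
  qed
  then have "card (g ` (Q - {x, x'})) \<le> card B" by (intro card_mono) (simp_all add: B_def)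
  also have "card B \<le> 2" by (simp add: B_def card_insert_if)
  finally have "card (g ` (Q - {x, x'})) \<le> 2" .
  moreover have "inj_on g (Q - {x, x'})" using \<open>x \<noteq> x'\<close> by (auto simp: inj_on_def g_def)
  moreover have "card (Q - {x, x'}) = card Q - 2"
    using assms \<open>x \<noteq> x'\<close> by (simp add: card_Diff_subset)
  ultimately show False using assms(2) by (simp add: card_image)
qed


section \<open>The bound for points with distinct coordinates\<close>

lemma card_right_triangles_bound:
  assumes "finite Q" and n: "card Q \<ge> 5" and Re: "inj_on Re Q" and Im: "inj_on Im Q"
  shows "3 * card (right_triangles Q) + 5 \<le> 2 * (card Q - 1)\<^sup>2"
proof -
  define m where "m = card Q - 1"
  define X where "X x = seen_from x Q" for x
  define q where "q x = card (quarter_turns (X x))" for x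
  define turn where "turn d x = card {v \<in> quarter_turns (X x). Im (d * v) * Im (d * (\<i> * v)) < 0}" for d x
  define acute where
    "acute d x = card (acute_middles d (X x) (1 + \<i>)) + card (acute_middles d (X x) (1 - \<i>))" for d x
  define e where "e x = card {Min (norm ` X x), Max (norm ` X x)}" for x
  define mI where "mI x = min (card {y\<in>Q. Im y > Im x}) (card {y\<in>Q. Im y < Im x})" for x
  define mR where "mR x = min (card {y\<in>Q. Re y > Re x}) (card {y\<in>Q. Re y < Re x})" for x
  have fin: "finite (X x)" for x using \<open>finite Q\<close> by (simp add: X_def finite_seen_from)
  have cardX: "card (X x) = m" if "x \<in> Q" for x
    using that \<open>finite Q\<close> by (simp add: X_def seen_from_def card_image inj_on_def m_def)
  have X_ne: "X x \<noteq> {}" if "x \<in> Q" for x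
    using cardX[OF that] n by (auto simp: m_def)
  have axes: "Re v \<noteq> 0 \<and> Im v \<noteq> 0" if "x \<in> Q" "v \<in> X x" for x v
    using that Re Im by (auto simp: X_def seen_from_def inj_on_def)
  have local: "4 * q x + (turn 1 x + acute 1 x) + (turn \<i> x + acute \<i> x) + 2 * e x
      \<le> 2 * m + 4 * mI x + 4 * mR x" if x: "x \<in> Q" for x
  proof -
    \<comment> \<open>\<open>v\<close> and \<open>\<i> * v\<close> lie in adjacent quadrants, so the
      origin separates them in only one of the two directions; the fifth copy of \<open>q x\<close>
      covers both \<open>turn\<close> counts.\<close>
    have "turn 1 x + turn \<i> x = card ({v \<in> quarter_turns (X x). Im (1 * v) * Im (1 * (\<i> * v)) < 0} \<union>
        {v \<in> quarter_turns (X x). Im (\<i> * v) * Im (\<i> * (\<i> * v)) < 0})"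
      unfolding turn_def using fin[of x]
      by (intro card_Un_disjoint[symmetric]) (auto simp: quarter_turns_def mult.commute)
    also have "\<dots> \<le> q x"
      unfolding q_def using fin[of x] by (intro card_mono) (auto simp: quarter_turns_def)
    finally have "turn 1 x + turn \<i> x \<le> q x" .
    moreover have "5 * q x + acute 1 x + acute \<i> x + 2 * e x \<le> 2 * card (X x) +
        4 * min (card {v\<in>X x. Im v > 0}) (card {v\<in>X x. Im v < 0}) +
        4 * min (card {v\<in>X x. Re v > 0}) (card {v\<in>X x. Re v < 0})"
      using local_count[OF fin X_ne[OF x] axes[OF x]] by (simp add: q_def acute_def e_def)
    moreover have "{y\<in>Q. y \<noteq> x \<and> Im (y - x) > 0} = {y\<in>Q. Im y > Im x}"
      "{y\<in>Q. y \<noteq> x \<and> Im (y - x) < 0} = {y\<in>Q. Im y < Im x}"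
      "{y\<in>Q. y \<noteq> x \<and> Re (y - x) > 0} = {y\<in>Q. Re y > Re x}"
      "{y\<in>Q. y \<noteq> x \<and> Re (y - x) < 0} = {y\<in>Q. Re y < Re x}"
      by auto
    ultimately show "4 * q x + (turn 1 x + acute 1 x) + (turn \<i> x + acute \<i> x) + 2 * e x
      \<le> 2 * m + 4 * mI x + 4 * mR x"
      using cardX[OF x] unfolding X_def card_seen_from_Collect mI_def mR_def by simp
  qed
  have "4 * (\<Sum>x\<in>Q. q x) + (\<Sum>x\<in>Q. turn 1 x + acute 1 x) + (\<Sum>x\<in>Q. turn \<i> x + acute \<i> x) +
      2 * (\<Sum>x\<in>Q. e x) \<le> card Q * (2 * m) + 4 * (\<Sum>x\<in>Q. mI x) + 4 * (\<Sum>x\<in>Q. mR x)"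
    using sum_mono[of Q, OF local, of "\<lambda>x. x"] by (simp add: sum.distrib flip: sum_distrib_left)
  moreover have "card (right_triangles Q) \<le> (\<Sum>x\<in>Q. q x)"
    using card_right_triangles_le_apex[OF \<open>finite Q\<close>] by (simp add: q_def X_def)
  moreover have "card (right_triangles Q) \<le> (\<Sum>x\<in>Q. turn 1 x + acute 1 x)"
    using card_right_triangles_le_middle[OF \<open>finite Q\<close>, of 1] Im by (simp add: turn_def acute_def X_def)
  moreover have "card (right_triangles Q) \<le> (\<Sum>x\<in>Q. turn \<i> x + acute \<i> x)"
    using card_right_triangles_le_middle[OF \<open>finite Q\<close>, of \<i>] Re by (simp add: turn_def acute_def X_def)
  moreover have "4 * (\<Sum>x\<in>Q. mI x) \<le> m\<^sup>2" "4 * (\<Sum>x\<in>Q. mR x) \<le> m\<^sup>2"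
    using sum_min_above_below[OF \<open>finite Q\<close>] Im Re by (simp_all add: mI_def mR_def m_def)
  moreover have "2 * card Q \<le> (\<Sum>x\<in>Q. e x) + 1"
  proof -
    \<comment> \<open>On \<open>C\<close> the closest and farthest distances agree and
      \<open>e x = 1\<close>; elsewhere \<open>e x = 2\<close>.\<close>
    define C where "C = {x\<in>Q. Min (norm ` X x) = Max (norm ` X x)}"
    have "x = x'" if "x \<in> C" "x' \<in> C" for x x'
    proof (rule equidistant_centre_unique[OF \<open>finite Q\<close> n])
      have const: "norm (y - z) = Max (norm ` X z)" if "z \<in> C" "y \<in> Q" "y \<noteq> z" for y z
      proof -
        have "norm (y - z) \<in> norm ` X z" using that by (auto simp: X_def seen_from_def)
        then show ?thesis
          using that fin[of z] by (metis (mono_tags, lifting) C_def Max_ge Min_le antisym finite_imageI mem_Collect_eq)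
      qed
      show "norm (y - x) = Max (norm ` X x)" if "y \<in> Q" "y \<noteq> x" for y using const \<open>x \<in> C\<close> that by blast
      show "norm (y - x') = Max (norm ` X x')" if "y \<in> Q" "y \<noteq> x'" for y using const \<open>x' \<in> C\<close> that by blast
    qed (use that in \<open>auto simp: C_def\<close>)
    moreover have "finite C" using \<open>finite Q\<close> by (simp add: C_def)
    ultimately have "card C \<le> 1" by (simp add: card_le_Suc0_iff_eq)
    moreover have "(\<Sum>x\<in>Q. e x + of_bool (x \<in> C)) = (\<Sum>x\<in>Q. 2)"
      by (rule sum.cong) (auto simp: e_def C_def)
    then have "(\<Sum>x\<in>Q. e x) + card C = 2 * card Q"
      using \<open>finite Q\<close> by (simp add: sum.distrib sum_of_bool_eq C_def Int_def)
    ultimately show ?thesis by simp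
  qed
  moreover have "card Q = Suc m" "m \<ge> 4" using n by (simp_all add: m_def)
  ultimately have "6 * card (right_triangles Q) + 4 * Suc m \<le> Suc m * (2 * m) + 2 * m\<^sup>2 + 2" by simp
  \<comment> \<open>With \<open>N = card (right_triangles Q)\<close>, the inequality so far reads
    \<open>6 N <= 4 m^2 - 2 m - 2\<close>, and \<open>2 m + 2 >= 10\<close>.\<close>
  then have "6 * card (right_triangles Q) + 10 \<le> 4 * m\<^sup>2"
    using \<open>m \<ge> 4\<close> by (simp add: power2_eq_square)
  then show ?thesis by (simp add: m_def)
qed

section \<open>From the Euclidean plane to complex numbers in general position\<close>

text \<open>Each nonzero \<open>z\<close> rules out at most one \<open>t\<close> per condition, so
  some factor \<open>Complex 1 t\<close> suits all of \<open>D\<close>. It rotates and scales, which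
  preserves the shape of triangles.\<close>

lemma exists_generic_rotation:
  fixes D :: "complex set"
  assumes "finite D" "0 \<notin> D"
  shows "\<exists>w. \<forall>z\<in>D. Re (w * z) \<noteq> 0 \<and> Im (w * z) \<noteq> 0"
proof -
  \<comment> \<open>A zero denominator yields the quotient 0 and excludes \<open>t = 0\<close>,
    which is harmless: the corresponding condition then holds for every \<open>t\<close>.\<close>
  define B where "B = (\<lambda>z. Re z / Im z) ` D \<union> (\<lambda>z. - Im z / Re z) ` D"
  have "finite B" using assms by (simp add: B_def)
  then obtain t where t: "t \<notin> B" using ex_new_if_finite infinite_UNIV_char_0 by blast
  have "Re (Complex 1 t * z) \<noteq> 0 \<and> Im (Complex 1 t * z) \<noteq> 0" if z: "z \<in> D" for z
  proof -
    have "z \<noteq> 0" using assms z by blast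
    have "t \<noteq> Re z / Im z" "t \<noteq> - Im z / Re z" using t z unfolding B_def by blast+
    moreover have "Re z = t * Im z" if "Re (Complex 1 t * z) = 0" using that by simp
    moreover have "- Im z = t * Re z" if "Im (Complex 1 t * z) = 0" using that by simp
    moreover have "Re z \<noteq> 0 \<or> Im z \<noteq> 0" using \<open>z \<noteq> 0\<close> by (auto simp: complex_eq_iff)
    ultimately show ?thesis by (metis mult_zero_right neg_equal_0_iff_equal nonzero_mult_div_cancel_right)
  qed
  then show ?thesis by blast
qed

text \<open>Perpendicular legs of equal length differ by a quarter turn in one of the two senses,
  and multiplication by \<open>w\<close> commutes with that by \<open>\<i>\<close>.\<close>

lemma isosceles_right_triangle_quarter_turn:
  fixes a b c :: "real ^ 2" and w :: complex
  assumes "isosceles_right_triangle a b c"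
  defines "z \<equiv> \<lambda>p::real ^ 2. w * Complex (p $ 1) (p $ 2)"
  shows "z c = z a + \<i> * (z b - z a) \<or> z b = z a + \<i> * (z c - z a)"
proof -
  define u v where "u = b - a" and "v = c - a"
  have "norm u = norm v" "u \<bullet> v = 0"
    using assms(1) unfolding isosceles_right_triangle_def u_def v_def
    by (auto simp: dist_norm norm_minus_commute orthogonal_def)
  then have eqs: "(u $ 1)\<^sup>2 + (u $ 2)\<^sup>2 = (v $ 1)\<^sup>2 + (v $ 2)\<^sup>2" "u $ 1 * v $ 1 + u $ 2 * v $ 2 = 0"
    by (simp_all add: norm_eq inner_vec_def sum_2 power2_eq_square)
  define U V where "U = Complex (u $ 1) (u $ 2)" and "V = Complex (v $ 1) (v $ 2)"
  \<comment> \<open>\<open>s\<close> is the squared leg length and \<open>k\<close> the cross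
    product of the legs. Lagrange's identity gives \<open>k^2 = s^2\<close>; the sign of
    \<open>k\<close> is the sense of the turn.\<close>
  define s k where "s = (u $ 1)\<^sup>2 + (u $ 2)\<^sup>2" and "k = u $ 1 * v $ 2 - u $ 2 * v $ 1"
  have "k\<^sup>2 = s\<^sup>2" and k: "k * u $ 1 = s * v $ 2" "k * u $ 2 = - s * v $ 1"
    using eqs unfolding s_def k_def by algebra+
  then consider "s = 0" | "k = s" "s \<noteq> 0" | "k = - s" "s \<noteq> 0" by (auto simp: power2_eq_iff)
  then have "V = \<i> * U \<or> U = \<i> * V"
  proof cases
    case 1
    then show ?thesis
      using eqs(1) by (simp add: s_def U_def V_def complex_eq_iff sum_power2_eq_zero_iff)
  next
    case 2
    then have "s * (v $ 2 - u $ 1) = 0" "s * (v $ 1 + u $ 2) = 0"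
      using k by (simp_all add: algebra_simps)
    then show ?thesis using \<open>s \<noteq> 0\<close> by (simp add: U_def V_def complex_eq_iff add_eq_0_iff)
  next
    case 3
    then have "s * (v $ 2 + u $ 1) = 0" "s * (v $ 1 - u $ 2) = 0"
      using k by (simp_all add: algebra_simps)
    then show ?thesis using \<open>s \<noteq> 0\<close> by (simp add: U_def V_def complex_eq_iff add_eq_0_iff)
  qed
  moreover have "z b - z a = w * U" "z c - z a = w * V"
    by (simp_all add: z_def U_def V_def u_def v_def complex_eq_iff algebra_simps)
  ultimately show ?thesis
    by (metis add.commute diff_add_cancel mult.left_commute)
qed

text \<open>The inverse \<open>y\<close> of \<open>z\<close> turns an encoded pair back into a set
  of points, and every triangle of \<open>P\<close> arises from some pair.\<close>

lemma S_triangle_le_card_right_triangles: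
  fixes w :: complex
  defines "z \<equiv> \<lambda>p::real ^ 2. w * Complex (p $ 1) (p $ 2)"
  assumes "finite P" "inj_on z P"
  shows "S_triangle P \<le> card (right_triangles (z ` P))"
proof -
  define y where "y = inv_into P z"
  have y: "y (z p) = p" if "p \<in> P" for p using that assms(3) by (simp add: y_def)
  define tri where "tri = (\<lambda>(a, b). {y a, y b, y (a + \<i> * (b - a))})"
  have "{T. T \<subseteq> P \<and> card T = 3 \<and> (\<exists>a b c. T = {a, b, c} \<and> isosceles_right_triangle a b c)}
      \<subseteq> tri ` right_triangles (z ` P)"
  proof clarify
    fix a b c :: "real ^ 2"
    assume abc: "{a, b, c} \<subseteq> P" "card {a, b, c} = 3" "isosceles_right_triangle a b c"
    have "a \<noteq> b" "a \<noteq> c" using abc(2) by (auto simp: card_insert_if split: if_splits)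
    then have ne: "z a \<noteq> z b" "z a \<noteq> z c" using abc(1) assms(3) by (auto simp: inj_on_def)
    from isosceles_right_triangle_quarter_turn[OF abc(3), of w]
    consider "z c = z a + \<i> * (z b - z a)" | "z b = z a + \<i> * (z c - z a)"
      by (auto simp: z_def)
    then show "{a, b, c} \<in> tri ` right_triangles (z ` P)"
    proof cases
      case 1
      then have "(z a, z b) \<in> right_triangles (z ` P)" "tri (z a, z b) = {a, b, c}"
        using abc(1) ne y by (auto simp: right_triangles_def tri_def simp flip: 1)
      then show ?thesis by (metis imageI)
    next
      case 2
      then have "(z a, z c) \<in> right_triangles (z ` P)" "tri (z a, z c) = {a, b, c}"
        using abc(1) ne y by (auto simp: right_triangles_def tri_def simp flip: 2)
      then show ?thesis by (metis imageI)
    qed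
  qed
  then show ?thesis
    unfolding S_triangle_def using finite_right_triangles[of "z ` P"] \<open>finite P\<close>
    by (meson card_image_le card_mono finite_imageI le_trans)
qed

lemma S_triangle_bound:
  assumes "finite P" "card P \<ge> 5"
  shows "3 * S_triangle P + 5 \<le> 2 * (card P - 1)\<^sup>2"
proof -
  define e where "e p = Complex (p $ 1) (p $ 2)" for p :: "real ^ 2"
  have inj_e: "e p = e q \<longleftrightarrow> p = q" for p q
    by (auto simp: e_def vec_eq_iff forall_2)
  \<comment> \<open>Distinct points get distinct coordinates once no difference in \<open>D\<close>
    is rotated onto an axis.\<close>
  define D where "D = (\<lambda>(p, q). e p - e q) ` {(p, q) \<in> P \<times> P. p \<noteq> q}"
  have "finite D" unfolding D_def using \<open>finite P\<close>
    by (intro finite_imageI) (rule finite_subset[of _ "P \<times> P"], auto)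
  moreover have "0 \<notin> D" by (auto simp: D_def inj_e)
  ultimately obtain w where w: "\<forall>z\<in>D. Re (w * z) \<noteq> 0 \<and> Im (w * z) \<noteq> 0"
    using exists_generic_rotation by blast
  define z where "z p = w * e p" for p
  have sep: "Re (z p) \<noteq> Re (z q) \<and> Im (z p) \<noteq> Im (z q)" if "p \<in> P" "q \<in> P" "p \<noteq> q" for p q
  proof -
    have "e p - e q \<in> D" using that by (force simp: D_def)
    then show ?thesis using bspec[OF w, of "e p - e q"] by (simp add: z_def algebra_simps)
  qed
  have inj: "inj_on z P" using sep by (metis inj_onI)
  have "inj_on Re (z ` P)" "inj_on Im (z ` P)" using sep by (auto simp: inj_on_def)
  moreover have "card (z ` P) = card P" using inj by (rule card_image)
  ultimately have "3 * card (right_triangles (z ` P)) + 5 \<le> 2 * (card P - 1)\<^sup>2"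
    using card_right_triangles_bound[of "z ` P"] assms by simp
  moreover have "S_triangle P \<le> card (right_triangles (z ` P))"
    using S_triangle_le_card_right_triangles[of P w] assms(1) inj unfolding z_def e_def by blast
  ultimately show ?thesis by linarith
qed

theorem theorem4:
  fixes n :: nat
  assumes "n \<ge> 3"
  shows "int (S_triangle_max n) \<le> \<lfloor>2 / 3 * (real n - 1)\<^sup>2 - 5 / 3\<rfloor>"
proof -
  have "S_triangle_max n \<in> {S_triangle P | P. finite P \<and> card P = n}"
    unfolding S_triangle_max_def
    using finite_S_triangle_values S_triangle_values_nonempty by (rule Max_in)
  then obtain P where P: "finite P" "card P = n" and max: "S_triangle_max n = S_triangle P" by auto
  have "3 * S_triangle P + 5 \<le> 2 * (n - 1)\<^sup>2"
  proof -
    \<comment> \<open>For 3 and 4 points the trivial bound \<open>n choose 3\<close> suffices: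
      \<open>3 * 1 + 5 = 8\<close> and \<open>3 * 4 + 5 = 17\<close>, against 8 and 18.\<close>
    consider "n = 3" | "n = 4" | "n \<ge> 5" using assms by linarith
    then show ?thesis
    proof cases
      case 3
      then show ?thesis using S_triangle_bound P by blast
    qed (use S_triangle_le_choose[OF P(1)] P(2) in \<open>auto simp: eval_nat_numeral\<close>)
  qed
  then have "real (3 * S_triangle P + 5) \<le> real (2 * (n - 1)\<^sup>2)" by (simp only: of_nat_le_iff)
  then have "real (S_triangle P) \<le> 2 / 3 * (real n - 1)\<^sup>2 - 5 / 3"
    using assms by (simp add: of_nat_diff)
  then show ?thesis by (simp add: max le_floor_iff)
qed

end
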